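(* Let $\chi$ be a Dirichlet character of conductor $f\in\mathbb{Z}^+$ and let $k$ be a positive integer. Then $$L_q(1-k,\chi)=-\frac{\beta_{k,\chi}(q)}{k}.$$
   Context: Let $q\in\mathbb{C}$ with $0<|q|<1$, and put $[m]=\frac{1-q^m}{1-q}$. A Dirichlet character of conductor $f$ is viewed as a primitive character modulo $f$. The generalized $q$-Bernoulli numbers attached to $\chi$, $\beta_{n,\chi}(q)$ ($n\ge0$), are defined by $$-t\sum_{a=1}^{f}\chi(a)\sum_{m=0}^{\infty}q^{fm+a}e^{[fm+a]t}=\sum_{n=0}^{\infty}\beta_{n,\chi}(q)\frac{t^n}{n!}.$$ The $q$-$L$-function is $$L_q(s,\chi)=\sum_{m=1}^{\infty}\frac{\chi(m)q^m}{[m]^s},\qquad s\in\mathbb{C}.$$ At $s=1-k$ with $k\ge1$ an integer, $[m]^{-s}$ is the ordinary power $[m]^{k-1}$. *)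

theory Defs
  imports "HOL-Complex_Analysis.Complex_Analysis" "HOL-Number_Theory.Cong"
begin

definition dirichlet_character :: "nat \<Rightarrow> (int \<Rightarrow> complex) \<Rightarrow> bool" where
  "dirichlet_character n chi \<longleftrightarrow> n > 0 \<and>
     (\<forall>a. chi (a + int n) = chi a) \<and>
     (\<forall>a b. chi (a * b) = chi a * chi b) \<and>
     (\<forall>a. chi a = 0 \<longleftrightarrow> \<not> coprime a (int n))"

text \<open>
  A divisor \<open>d\<close> of the modulus is an induced modulus if \<open>chi\<close> factors through the units modulo
  \<open>d\<close>; the conductor is the least one.
\<close>

definition induced_modulus :: "nat \<Rightarrow> (int \<Rightarrow> complex) \<Rightarrow> nat \<Rightarrow> bool" where
  "induced_modulus n chi d \<longleftrightarrow> d > 0 \<and> d dvd n \<and>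
     (\<forall>a. coprime a (int n) \<and> [a = 1] (mod int d) \<longrightarrow> chi a = 1)"

definition conductor :: "nat \<Rightarrow> (int \<Rightarrow> complex) \<Rightarrow> nat" where
  "conductor n chi = (LEAST d. induced_modulus n chi d)"

definition primitive_character :: "nat \<Rightarrow> (int \<Rightarrow> complex) \<Rightarrow> bool" where
  "primitive_character f chi \<longleftrightarrow> dirichlet_character f chi \<and> conductor f chi = f"

definition q_number :: "complex \<Rightarrow> nat \<Rightarrow> complex" where
  "q_number q m = (1 - q ^ m) / (1 - q)"

definition q_bernoulli_gf :: "complex \<Rightarrow> nat \<Rightarrow> (int \<Rightarrow> complex) \<Rightarrow> complex \<Rightarrow> complex" where
  "q_bernoulli_gf q f chi t =
     - t * (\<Sum>a=1..f. chi (int a) *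
              (\<Sum>m. q ^ (f * m + a) * exp (q_number q (f * m + a) * t)))"

text \<open>
  The defining identity of the generalized \<open>q\<close>-Bernoulli numbers, read as a convergent power series
  expansion around \<open>t = 0\<close>. Lemma \<open>ex1_q_bernoulli\<close> below shows that it determines the numbers
  uniquely.
\<close>

definition q_bernoulli :: "complex \<Rightarrow> nat \<Rightarrow> (int \<Rightarrow> complex) \<Rightarrow> nat \<Rightarrow> complex" where
  "q_bernoulli q f chi =
     (THE \<beta>. q_bernoulli_gf q f chi has_fps_expansion Abs_fps (\<lambda>n. \<beta> n / fact n))"

text \<open>The complex power is the one given by the principal branch of the logarithm.\<close>

definition q_L :: "complex \<Rightarrow> complex \<Rightarrow> (int \<Rightarrow> complex) \<Rightarrow> complex" where
  "q_L q s chi = (\<Sum>m. chi (int (Suc m)) * q ^ Suc m / q_number q (Suc m) powr s)"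

lemma norm_q_number_le:
  assumes "norm q < 1"
  shows "norm (q_number q m) \<le> 2 / norm (1 - q)"
proof -
  have "norm (1 - q ^ m) \<le> norm (1::complex) + norm (q ^ m)"
    by (rule norm_triangle_ineq4)
  also have "\<dots> \<le> 2"
    using assms by (simp add: norm_power power_le_one)
  finally show ?thesis
    by (simp add: q_number_def norm_divide divide_right_mono)
qed

lemma holomorphic_q_bernoulli_gf:
  assumes q: "norm q < 1" and f: "f > 0"
  shows "q_bernoulli_gf q f chi holomorphic_on UNIV"
proof -
  define g where "g a m t = q ^ (f * m + a) * exp (q_number q (f * m + a) * t)"
    for a m :: nat and t :: complex
  define C where "C = 2 / norm (1 - q)"
  have bound: "norm (g a m t) \<le> norm q ^ m * exp (C * R)" if "norm t \<le> R" for a m t R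
  proof -
    have "R \<ge> 0" using that norm_ge_zero order_trans by blast
    have "m \<le> f * m + a" using f by (simp add: trans_le_add1)
    then have "norm q ^ (f * m + a) \<le> norm q ^ m"
      using q by (intro power_decreasing) auto
    moreover have "norm (exp (q_number q (f * m + a) * t)) \<le> exp (C * R)"
    proof -
      have "Re (q_number q (f * m + a) * t) \<le> norm (q_number q (f * m + a) * t)"
        by (rule complex_Re_le_cmod)
      also have "\<dots> \<le> C * R"
        unfolding norm_mult C_def
        by (intro mult_mono norm_q_number_le q that) auto
      finally show ?thesis by simp
    qed
    ultimately show ?thesis
      unfolding g_def norm_mult norm_power by (intro mult_mono) auto
  qed
  have "(\<lambda>t. \<Sum>m. g a m t) holomorphic_on UNIV" for a
  proof (rule holomorphic_uniform_sequence)
    show "(\<lambda>t. \<Sum>m<n. g a m t) holomorphic_on UNIV" for n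
      unfolding g_def by (intro holomorphic_intros)
    show "\<exists>d>0. cball z d \<subseteq> UNIV \<and>
            uniform_limit (cball z d) (\<lambda>n t. \<Sum>m<n. g a m t) (\<lambda>t. \<Sum>m. g a m t) sequentially" for z
    proof (intro exI[of _ 1] conjI)
      show "uniform_limit (cball z 1) (\<lambda>n t. \<Sum>m<n. g a m t) (\<lambda>t. \<Sum>m. g a m t) sequentially"
      proof (rule Weierstrass_m_test)
        fix m t assume "t \<in> cball z 1"
        then have "norm t \<le> norm z + 1"
          using norm_triangle_sub[of t z] by (simp add: dist_norm norm_minus_commute)
        then show "norm (g a m t) \<le> norm q ^ m * exp (C * (norm z + 1))" by (rule bound)
      next
        show "summable (\<lambda>m. norm q ^ m * exp (C * (norm z + 1)))"
          using q by (intro summable_mult2 summable_geometric) auto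
      qed
    qed auto
  qed auto
  then have "(\<lambda>t. - t * (\<Sum>a=1..f. chi (int a) * (\<Sum>m. g a m t))) holomorphic_on UNIV"
    by (intro holomorphic_intros)
  then show ?thesis
    unfolding q_bernoulli_gf_def g_def by simp
qed

lemma ex1_q_bernoulli:
  assumes "norm q < 1" "f > 0"
  shows "\<exists>!\<beta>. q_bernoulli_gf q f chi has_fps_expansion Abs_fps (\<lambda>n. \<beta> n / fact n)"
proof -
  define F where "F = fps_expansion (q_bernoulli_gf q f chi) 0"
  have "q_bernoulli_gf q f chi analytic_on {0}"
    using holomorphic_q_bernoulli_gf[OF assms] by (auto simp: analytic_at)
  then have F: "q_bernoulli_gf q f chi has_fps_expansion F"
    unfolding F_def by (rule analytic_at_imp_has_fps_expansion_0)
  show ?thesis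
  proof (rule ex1I)
    have "Abs_fps (\<lambda>n. fact n * fps_nth F n / fact n) = F"
      by (simp add: fps_eq_iff)
    with F show "q_bernoulli_gf q f chi has_fps_expansion
        Abs_fps (\<lambda>n. fact n * fps_nth F n / fact n)"
      by simp
  next
    fix \<beta> assume "q_bernoulli_gf q f chi has_fps_expansion Abs_fps (\<lambda>n. \<beta> n / fact n)"
    then have "Abs_fps (\<lambda>n. \<beta> n / fact n) = F"
      using F fps_expansion_unique_complex by blast
    then have "\<beta> n / fact n = fps_nth F n" for n
      by (metis fps_nth_Abs_fps)
    then show "\<beta> = (\<lambda>n. fact n * fps_nth F n)"
      by (intro ext) (metis fact_nonzero nonzero_mult_div_cancel_left times_divide_eq_right)
  qed
qed

end

theory Submission
  imports Defs
begin

text \<open>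
  Because \<open>chi\<close> has period \<open>f\<close>, the sum over residue classes in the generating function collapses
  to one series over all positive integers:
  \<open>- t * (\<Sum>j\<ge>1. chi j * q ^ j * exp ([j] * t))\<close>. The numbers \<open>[j]\<close> stay bounded because \<open>|q| < 1\<close>, so
  expanding every exponential gives an absolutely convergent double series, and interchanging the
  two summations shows that the coefficient of \<open>t ^ k\<close> is
  \<open>- (\<Sum>j\<ge>1. chi j * q ^ j * [j] ^ (k - 1)) / (k - 1)!\<close>. The sum in this expression is the
  \<open>q\<close>-\<open>L\<close>-value at \<open>1 - k\<close>, and the coefficient is by definition the \<open>k\<close>-th Bernoulli number
  divided by \<open>k!\<close>; the quotient \<open>k! / (k - 1)! = k\<close> is the denominator in the theorem.

  The collapse is \<open>suminf_residue_classes\<close>, the interchange is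
  \<open>has_fps_expansion_suminf_exp\<close>. Absolute convergence also uses that a periodic function on the
  integers is bounded.
\<close>

text \<open>
  The shift by one makes the representatives \<open>1, \<dots>, n\<close> of the residue classes, which is the range
  used in the generating function, fit a series indexed from \<open>0\<close>.
\<close>

lemma suminf_residue_classes:
  fixes g :: "nat \<Rightarrow> 'a :: real_normed_vector"
  assumes "n > 0"
    and total: "summable (\<lambda>j. g (Suc j))"
    and classes: "\<And>a. summable (\<lambda>m. g (n * m + a))"
  shows "(\<Sum>a=1..n. \<Sum>m. g (n * m + a)) = (\<Sum>j. g (Suc j))"
proof -
  have block: "(\<Sum>j\<in>{m * n..<m * n + n}. g (Suc j)) = (\<Sum>a=1..n. g (n * m + a))" for m
    by (rule sum.reindex_bij_witness[of _ "\<lambda>a. m * n + a - 1" "\<lambda>j. Suc j - m * n"])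
       (auto simp: mult.commute)
  have "(\<lambda>m. \<Sum>a=1..n. g (n * m + a)) sums (\<Sum>j. g (Suc j))"
    using sums_group[OF summable_sums[OF total] \<open>n > 0\<close>] by (simp add: block)
  moreover have "(\<lambda>m. \<Sum>a=1..n. g (n * m + a)) sums (\<Sum>a=1..n. \<Sum>m. g (n * m + a))"
    by (intro sums_sum summable_sums classes)
  ultimately show ?thesis
    by (rule sums_unique2[symmetric])
qed

text \<open>
  Expanding each exponential gives a double series dominated by
  \<open>norm (c m) * (C * norm t) ^ n / n!\<close>, a product of two convergent series. Hence it may be summed
  in either order.
\<close>

lemma has_fps_expansion_suminf_exp:
  fixes c x :: "nat \<Rightarrow> complex"
  assumes c: "summable (\<lambda>m. norm (c m))" and x: "\<And>m. norm (x m) \<le> C"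
  shows "(\<lambda>t. \<Sum>m. c m * exp (x m * t)) has_fps_expansion
           Abs_fps (\<lambda>n. (\<Sum>m. c m * x m ^ n) / fact n)"
proof (rule has_fps_expansionI, rule always_eventually, rule allI)
  fix t :: complex
  define h where "h = (\<lambda>m n. c m * ((x m * t) ^ n /\<^sub>R fact n))"
  have "C \<ge> 0"
    using x[of 0] norm_ge_zero order_trans by blast
  have c': "summable (\<lambda>m. norm (c m * x m ^ n))" for n
  proof (rule summable_comparison_test')
    show "norm (norm (c m * x m ^ n)) \<le> norm (c m) * C ^ n" for m
      using power_mono[OF x norm_ge_zero, of m n]
      by (simp add: norm_mult norm_power mult_left_mono)
    show "summable (\<lambda>m. norm (c m) * C ^ n)"
      by (intro summable_mult2 c)
  qed
  have exp_bound: "summable (\<lambda>n. norm (h m n))" for m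
    unfolding h_def norm_mult by (intro summable_mult summable_norm_exp)
  have "(\<lambda>p. norm (case p of (m, n) \<Rightarrow> h m n)) summable_on UNIV \<times> UNIV"
  proof (rule Infinite_Sum.abs_summable_on_comparison_test')
    have "((\<lambda>n. (C * norm t) ^ n /\<^sub>R fact n) has_sum exp (C * norm t)) UNIV"
      using \<open>C \<ge> 0\<close> by (intro sums_nonneg_imp_has_sum exp_converges) auto
    then have "((\<lambda>n. norm (c m) * ((C * norm t) ^ n /\<^sub>R fact n)) has_sum
        norm (c m) * exp (C * norm t)) UNIV" for m
      by (rule has_sum_cmult_right)
    moreover have "(\<lambda>m. norm (c m) * exp (C * norm t)) summable_on UNIV"
      using c by (intro summable_nonneg_imp_summable_on summable_mult2) auto
    ultimately show "(\<lambda>(m, n). norm (c m) * ((C * norm t) ^ n /\<^sub>R fact n)) summable_on UNIV \<times> UNIV"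
      using \<open>C \<ge> 0\<close>
      by (intro summable_on_SigmaI[where g = "\<lambda>m. norm (c m) * exp (C * norm t)"]) simp_all
  next
    fix p :: "nat \<times> nat"
    obtain m n where "p = (m, n)" by (cases p)
    moreover have "norm (h m n) \<le> norm (c m) * ((C * norm t) ^ n /\<^sub>R fact n)"
      unfolding h_def norm_mult norm_scaleR norm_power power_mult_distrib real_scaleR_def
      by (intro mult_mono power_mono x) (use \<open>C \<ge> 0\<close> in auto)
    ultimately show "norm (case p of (m, n) \<Rightarrow> h m n)
        \<le> (case p of (m, n) \<Rightarrow> norm (c m) * ((C * norm t) ^ n /\<^sub>R fact n))"
      by simp
  qed
  from abs_summable_summable[OF this]
  obtain S where S: "((\<lambda>(m, n). h m n) has_sum S) (UNIV \<times> UNIV)"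
    unfolding summable_on_def ..
  have row: "(h m has_sum c m * exp (x m * t)) UNIV" for m
    using exp_bound unfolding h_def
    by (intro norm_summable_imp_has_sum sums_mult exp_converges) auto
  have col: "((\<lambda>m. h m n) has_sum (\<Sum>m. c m * x m ^ n) / fact n * t ^ n) UNIV" for n
  proof (rule norm_summable_imp_has_sum)
    have eq: "h m n = c m * x m ^ n * (t ^ n / fact n)" for m
      by (simp add: h_def power_mult_distrib scaleR_conv_of_real divide_inverse)
    show "summable (\<lambda>m. norm (h m n))"
      unfolding eq norm_mult[of _ "t ^ n / fact n"] by (intro summable_mult2 c')
    show "(\<lambda>m. h m n) sums ((\<Sum>m. c m * x m ^ n) / fact n * t ^ n)"
      using sums_mult2[OF summable_sums[OF summable_norm_cancel[OF c']], of n "t ^ n / fact n"]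
      by (simp add: eq)
  qed
  have "((\<lambda>m. c m * exp (x m * t)) has_sum S) UNIV"
    by (rule has_sum_SigmaD[OF S]) (simp add: row)
  then have "S = (\<Sum>m. c m * exp (x m * t))"
    by (intro sums_unique has_sum_imp_sums)
  moreover have "((\<lambda>n. (\<Sum>m. c m * x m ^ n) / fact n * t ^ n) has_sum S) UNIV"
    by (rule has_sum_SigmaD[OF has_sum_swap[THEN iffD1, OF S]]) (use col in simp)
  ultimately show "(\<lambda>n. fps_nth (Abs_fps (\<lambda>n. (\<Sum>m. c m * x m ^ n) / fact n)) n * t ^ n)
          sums (\<Sum>m. c m * exp (x m * t))"
    using has_sum_imp_sums by (simp only: fps_nth_Abs_fps)
qed

lemma dirichlet_character_residue:
  assumes "dirichlet_character n chi"
  shows "chi (int (n * m + a)) = chi (int a)"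
proof (induction m)
  case (Suc m)
  have "chi (int (n * Suc m + a)) = chi (int (n * m + a) + int n)"
    by (simp add: algebra_simps)
  with Suc assms show ?case
    by (simp add: dirichlet_character_def)
qed simp

lemma dirichlet_character_bounded:
  assumes "dirichlet_character n chi"
  obtains B where "\<And>j. norm (chi (int j)) \<le> B"
proof
  fix j
  have "n > 0"
    using assms by (simp add: dirichlet_character_def)
  have "chi (int j) = chi (int (j mod n))"
    using dirichlet_character_residue[OF assms, of "j div n" "j mod n"] by simp
  also have "norm \<dots> \<le> (\<Sum>a<n. norm (chi (int a)))"
    using \<open>n > 0\<close> by (intro member_le_sum) auto
  finally show "norm (chi (int j)) \<le> (\<Sum>a<n. norm (chi (int a)))" .
qed

lemma summable_character_power:
  fixes q :: complex
  assumes "norm q < 1" and "dirichlet_character n chi"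
  shows "summable (\<lambda>j. norm (chi (int j) * q ^ j))"
proof -
  obtain B where B: "\<And>j. norm (chi (int j)) \<le> B"
    using assms(2) dirichlet_character_bounded by blast
  show ?thesis
  proof (rule summable_comparison_test')
    show "norm (norm (chi (int j) * q ^ j)) \<le> B * norm q ^ j" for j
      by (simp add: norm_mult norm_power mult_right_mono B)
    show "summable (\<lambda>j. B * norm q ^ j)"
      using assms(1) by (intro summable_mult summable_geometric) auto
  qed
qed

lemma q_number_neq_0:
  assumes "norm q < 1" and "m > 0"
  shows "q_number q m \<noteq> 0"
proof -
  have "norm (q ^ m) < 1"
    using assms by (simp add: norm_power power_less_one_iff)
  then have "q ^ m \<noteq> 1"
    by auto
  moreover have "q \<noteq> 1"
    using assms(1) by auto
  ultimately show ?thesis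
    by (simp add: q_number_def)
qed

text \<open>
  The exponent \<open>1 - k\<close> is the negative of a natural number, so the principal branch agrees with the
  ordinary power. That \<open>[j]\<close> does not vanish matters already for \<open>k = 1\<close>, because \<open>0 powr 0 = 0\<close>.
\<close>

lemma q_L_nonpos_int:
  assumes "norm q < 1" and "k > 0"
  shows "q_L q (1 - of_nat k) chi =
           (\<Sum>j. chi (int (Suc j)) * q ^ Suc j * q_number q (Suc j) ^ (k - 1))"
proof -
  have "q_number q (Suc j) powr (1 - of_nat k) = inverse (q_number q (Suc j) ^ (k - 1))" for j
  proof -
    have "(1 - of_nat k :: complex) = - of_nat (k - 1)"
      using \<open>k > 0\<close> by (simp add: of_nat_diff)
    then show ?thesis
      using q_number_neq_0[OF assms(1), of "Suc j"]
      by (simp only: powr_minus powr_nat') simp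
  qed
  then show ?thesis
    by (simp only: q_L_def divide_inverse inverse_inverse_eq)
qed

lemma q_bernoulli_gf_eq:
  assumes q: "norm q < 1" and "f > 0" and chi: "dirichlet_character f chi"
  shows "q_bernoulli_gf q f chi t =
           - t * (\<Sum>j. (chi (int (Suc j)) * q ^ Suc j) * exp (q_number q (Suc j) * t))"
proof -
  define g where "g = (\<lambda>j. chi (int j) * q ^ j * exp (q_number q j * t))"
  define C where "C = exp (2 / norm (1 - q) * norm t)"
  have C: "norm (exp (q_number q j * t)) \<le> C" for j
    using complex_Re_le_cmod[of "q_number q j * t"]
      mult_right_mono[OF norm_q_number_le[OF q, of j] norm_ge_zero[of t]]
    unfolding C_def norm_exp_eq_Re by (simp add: norm_mult)
  have g: "summable (\<lambda>j. norm (g j))"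
  proof (rule summable_comparison_test')
    show "norm (norm (g j)) \<le> norm (chi (int j) * q ^ j) * C" for j
      using mult_left_mono[OF C norm_ge_zero[of "chi (int j) * q ^ j"]]
      by (simp add: g_def norm_mult)
    show "summable (\<lambda>j. norm (chi (int j) * q ^ j) * C)"
      by (intro summable_mult2 summable_character_power[OF q chi])
  qed
  have classes: "summable (\<lambda>m. g (f * m + a))" for a
  proof -
    have "strict_mono (\<lambda>m. f * m + a)"
      using \<open>f > 0\<close> by (simp add: strict_mono_def)
    then have "summable (\<lambda>m. norm (g (f * m + a)))"
      using summable_reindex[OF g, of "\<lambda>m. f * m + a"] strict_mono_imp_inj_on[of "\<lambda>m. f * m + a"]
      by (simp add: o_def)
    then show ?thesis
      by (rule summable_norm_cancel)
  qed
  have "chi (int a) * (\<Sum>m. q ^ (f * m + a) * exp (q_number q (f * m + a) * t)) =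
          (\<Sum>m. g (f * m + a))" for a
  \<comment> \<open>For \<open>chi (int a) \<noteq> 0\<close>, convergence of the series without the factor \<open>chi (int a)\<close> follows from
    that of \<open>g\<close> on the residue class, by dividing.\<close>
  proof (cases "chi (int a) = 0")
    case True
    then show ?thesis
      unfolding g_def by (simp only: dirichlet_character_residue[OF chi]) simp
  next
    case False
    have eq: "g (f * m + a) =
        chi (int a) * (q ^ (f * m + a) * exp (q_number q (f * m + a) * t))" for m
      unfolding g_def by (simp only: dirichlet_character_residue[OF chi] mult.assoc)
    have "summable (\<lambda>m. q ^ (f * m + a) * exp (q_number q (f * m + a) * t))"
      using classes[of a] False unfolding eq by (subst (asm) summable_cmult_iff) auto
    then show ?thesis
      unfolding eq by (rule suminf_mult[symmetric])
  qed
  moreover have "summable (\<lambda>j. g (Suc j))"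
    using summable_norm_cancel[OF g] by (simp only: summable_Suc_iff)
  ultimately show ?thesis
    using suminf_residue_classes[of f g] \<open>f > 0\<close> classes
    by (simp add: q_bernoulli_gf_def g_def)
qed

theorem theorem14:
  fixes q :: complex and chi :: "int \<Rightarrow> complex" and f k :: nat
  assumes "0 < norm q" and "norm q < 1"
    and "f > 0" and "primitive_character f chi"
    and "k > 0"
  shows "q_L q (1 - of_nat k) chi = - q_bernoulli q f chi k / of_nat k"
proof -
  have chi: "dirichlet_character f chi"
    using assms(4) by (simp add: primitive_character_def)
  define A where "A = (\<lambda>n. \<Sum>j. chi (int (Suc j)) * q ^ Suc j * q_number q (Suc j) ^ n)"
  have "summable (\<lambda>j. norm (chi (int (Suc j)) * q ^ Suc j))"
    using summable_character_power[OF assms(2) chi] by (subst summable_Suc_iff)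
  then have "(\<lambda>t. \<Sum>j. chi (int (Suc j)) * q ^ Suc j * exp (q_number q (Suc j) * t))
          has_fps_expansion Abs_fps (\<lambda>n. A n / fact n)"
    unfolding A_def by (rule has_fps_expansion_suminf_exp) (rule norm_q_number_le[OF assms(2)])
  then have "q_bernoulli_gf q f chi has_fps_expansion - fps_X * Abs_fps (\<lambda>n. A n / fact n)"
    unfolding q_bernoulli_gf_eq[OF assms(2,3) chi, abs_def] by (intro fps_expansion_intros)
  moreover have "q_bernoulli_gf q f chi has_fps_expansion
      Abs_fps (\<lambda>n. q_bernoulli q f chi n / fact n)"
    unfolding q_bernoulli_def by (rule theI'[OF ex1_q_bernoulli[OF assms(2,3)]])
  ultimately have "- fps_X * Abs_fps (\<lambda>n. A n / fact n) =
      Abs_fps (\<lambda>n. q_bernoulli q f chi n / fact n)"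
    by (rule fps_expansion_unique_complex)
  then have "fps_nth (- fps_X * Abs_fps (\<lambda>n. A n / fact n)) k = q_bernoulli q f chi k / fact k"
    by simp
  then have "q_bernoulli q f chi k / fact k = - (A (k - 1) / fact (k - 1))"
    using \<open>k > 0\<close> by simp
  moreover have "fact k = (of_nat k * fact (k - 1) :: complex)"
    using \<open>k > 0\<close> by (simp add: fact_reduce)
  ultimately have "q_bernoulli q f chi k = - (of_nat k * A (k - 1))"
    using \<open>k > 0\<close> by (simp add: field_simps)
  then show ?thesis
    using \<open>k > 0\<close> by (simp add: q_L_nonpos_int[OF assms(2)] A_def)
qed

end
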